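(* Suppose that $X$ is a compact LOTS with a monotone open closure-preserving operator $r$. Then $X$ is metrizable.
   Context: A LOTS is a linearly ordered set with its open-interval (order) topology. A family $\mathcal A$ refines a family $\mathcal B$ if every $A\in\mathcal A$ is contained in some $B\in\mathcal B$. A family $\mathcal F$ of subsets of $X$ is closure-preserving if $\overline{\bigcup\mathcal H}=\bigcup\{\overline H:H\in\mathcal H\}$ for every $\mathcal H\subseteq\mathcal F$. A monotone open closure-preserving operator for $X$ is a function $r$ assigning to every open cover $\mathcal U$ of $X$ a closure-preserving cover $r(\mathcal U)$ of $X$ by open sets that refines $\mathcal U$, such that whenever $\mathcal U,\mathcal V$ are open covers and $\mathcal U$ refines $\mathcal V$, then $r(\mathcal U)$ refines $r(\mathcal V)$. *)

theory Defs
  imports "HOL-Analysis.Analysis"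
begin

(* The library's Disjoint_Sets.refines is about partitions (it also requires disjointness),
   so refinement of arbitrary families is defined here. *)
definition family_refines :: "'a set set \<Rightarrow> 'a set set \<Rightarrow> bool" where
  "family_refines \<A> \<B> \<longleftrightarrow> (\<forall>A\<in>\<A>. \<exists>B\<in>\<B>. A \<subseteq> B)"

definition closure_preserving :: "'a::topological_space set set \<Rightarrow> bool" where
  "closure_preserving \<F> \<longleftrightarrow> (\<forall>\<H>\<subseteq>\<F>. closure (\<Union>\<H>) = (\<Union>H\<in>\<H>. closure H))"

definition open_cover :: "'a::topological_space set set \<Rightarrow> bool" where
  "open_cover \<U> \<longleftrightarrow> (\<forall>U\<in>\<U>. open U) \<and> \<Union>\<U> = UNIV"

(* The operator acts on open covers only: r is unconstrained on all other families. *)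
definition monotone_open_closure_preserving_operator ::
    "('a::topological_space set set \<Rightarrow> 'a set set) \<Rightarrow> bool" where
  "monotone_open_closure_preserving_operator r \<longleftrightarrow>
     (\<forall>\<U>. open_cover \<U> \<longrightarrow>
        open_cover (r \<U>) \<and> closure_preserving (r \<U>) \<and> family_refines (r \<U>) \<U>) \<and>
     (\<forall>\<U> \<V>. open_cover \<U> \<longrightarrow> open_cover \<V> \<longrightarrow> family_refines \<U> \<V> \<longrightarrow>
        family_refines (r \<U>) (r \<V>))"

end

theory Submission
  imports Defs
begin

text \<open>
  For \<open>x < y\<close> consider the cover \<open>{{..<y}, {x<..}}\<close> and choose members \<open>L x y \<ni> x\<close> and
  \<open>R x y \<ni> y\<close> of its image under \<open>r\<close>. Comparing many such covers with one common coarsening,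
  closure preservation shows that intervals \<open>[x, y]\<close> with \<open>c < x\<close> whose sets \<open>R x y\<close> all
  contain a common point \<open>e \<ge> y\<close> cannot have their right ends accumulate at \<open>c\<close>, and dually for
  \<open>L\<close>. By compactness, for given \<open>p\<close> and \<open>e\<close>, finitely many points meet all intervals
  \<open>[x, y] \<subseteq> [p, e]\<close> with \<open>p \<in> L x y\<close> and \<open>e \<in> R x y\<close>. A countable set \<open>D\<close> closed under adding
  these points (and some neighbours) meets every nondegenerate interval: in a gap \<open>(a, b)\<close> of
  \<open>closure D\<close>, the sets \<open>L a b\<close> and \<open>R a b\<close> contain points \<open>p \<le> a\<close> and \<open>e \<ge> b\<close> of \<open>D\<close>, so \<open>[a, b]\<close>
  is one of the intervals met by \<open>D\<close>. Urysohn functions for pairs from \<open>D\<close> then embed the space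
  into a countable power of the reals.
\<close>

section \<open>Closure preservation applied to many two-set covers at once\<close>

text \<open>Coarsen all the covers to a single one, with \<open>Q\<close> in place of every
  \<open>O' i\<close>. By monotonicity each \<open>V i\<close> lies in a member of the image of that
  cover. This member contains \<open>p\<close>, so it is not inside \<open>Q\<close> and must lie
  inside some \<open>U j\<close>, whose closure omits \<open>c\<close>. Closure preservation carries
  the omission over to the union of these members.\<close>

lemma closure_preserving_witnesses:
  assumes r: "monotone_open_closure_preserving_operator r"
    and cov: "\<And>i. i \<in> I \<Longrightarrow> open_cover {U i, O' i}"
    and sub: "\<And>i. i \<in> I \<Longrightarrow> O' i \<subseteq> Q" and Q: "open Q" "p \<notin> Q"
    and V: "\<And>i. i \<in> I \<Longrightarrow> V i \<in> r {U i, O' i} \<and> p \<in> V i \<and> z i \<in> V i"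
    and c: "\<And>i. i \<in> I \<Longrightarrow> c \<notin> closure (U i)"
  shows "c \<notin> closure (z ` I)"
\<comment> \<open>Without an index the common coarsening would be \<open>{Q}\<close> alone, which
  does not cover \<open>p\<close>.\<close>
proof (cases "I = {}")
  case False
  define \<W> where "\<W> = insert Q (U ` I)"
  have \<W>: "open_cover \<W>"
  proof -
    obtain i where "i \<in> I" using False by blast
    then have "U i \<union> Q = UNIV"
      using cov[of i] sub[of i] by (auto simp: open_cover_def)
    then show ?thesis
      using cov Q \<open>i \<in> I\<close> by (fastforce simp: open_cover_def \<W>_def)
  qed
  have ref: "family_refines (r \<W>) \<W>" and cp: "closure_preserving (r \<W>)"
    using r \<W> by (auto simp: monotone_open_closure_preserving_operator_def)
  have coarser: "\<exists>W\<in>r \<W>. V i \<subseteq> W" if "i \<in> I" for i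
  proof -
    have "family_refines {U i, O' i} \<W>"
      using sub that by (auto simp: family_refines_def \<W>_def)
    then have "family_refines (r {U i, O' i}) (r \<W>)"
      using r \<W> cov[OF that] by (auto simp: monotone_open_closure_preserving_operator_def)
    then show ?thesis
      using V[OF that] by (auto simp: family_refines_def)
  qed
  define \<H> where "\<H> = {W \<in> r \<W>. p \<in> W}"
  have "c \<notin> closure W" if W: "W \<in> \<H>" for W
  proof -
    obtain B where "B \<in> \<W>" "W \<subseteq> B"
      using W ref by (auto simp: \<H>_def family_refines_def)
    \<comment> \<open>This index may differ from the one whose \<open>V i\<close> lies in
      \<open>W\<close>; any index will do, because \<open>c\<close> avoids every
      \<open>closure (U i)\<close>.\<close>
    then obtain i where "i \<in> I" "W \<subseteq> U i"
      using W Q by (auto simp: \<H>_def \<W>_def)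
    then show ?thesis using c closure_mono by blast
  qed
  moreover have "closure (\<Union>\<H>) = (\<Union>H\<in>\<H>. closure H)"
    using cp by (auto simp: closure_preserving_def \<H>_def)
  moreover have "z ` I \<subseteq> \<Union>\<H>"
    using coarser V by (fastforce simp: \<H>_def)
  ultimately show ?thesis
    using closure_mono by blast
qed auto

lemma open_cover_rays:
  fixes x y :: "'a::linorder_topology"
  assumes "x < y"
  shows "open_cover {{..<y}, {x<..}}"
  using assms by (auto simp: open_cover_def)

text \<open>The bound \<open>y \<le> e\<close> lets \<open>{..<e}\<close> absorb all the sets
  \<open>{..<y}\<close>. It omits \<open>e\<close>, so \<open>e\<close> plays the part of
  \<open>p\<close> in the previous argument, and \<open>c < x\<close> keeps \<open>c\<close> out of
  the closure of \<open>{x<..}\<close>.\<close>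

lemma right_ends_not_accumulating:
  fixes r :: "'a::linorder_topology set set \<Rightarrow> 'a set set"
  assumes r: "monotone_open_closure_preserving_operator r"
    and R: "\<And>x y. x < y \<Longrightarrow> y \<in> R x y \<and> R x y \<in> r {{..<y}, {x<..}}"
  shows "c \<notin> closure {y | x y. c < x \<and> x < y \<and> y \<le> e \<and> e \<in> R x y}"
proof -
  define I where "I = {(x, y). c < x \<and> x < y \<and> y \<le> e \<and> e \<in> R x y}"
  have "c \<notin> closure (snd ` I)"
  proof (rule closure_preserving_witnesses[OF r,
        where U = "\<lambda>(x, y). {x<..}" and O' = "\<lambda>(x, y). {..<y}" and V = "\<lambda>(x, y). R x y"
          and Q = "{..<e}" and p = e])
    fix i assume "i \<in> I"
    then obtain x y where i: "i = (x, y)" "c < x" "x < y" "y \<le> e" "e \<in> R x y"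
      by (auto simp: I_def)
    show "open_cover {case i of (x, y) \<Rightarrow> {x<..}, case i of (x, y) \<Rightarrow> {..<y}}"
      using open_cover_rays[OF i(3)] i(1) by (simp add: insert_commute)
    show "(case i of (x, y) \<Rightarrow> R x y)
        \<in> r {case i of (x, y) \<Rightarrow> {x<..}, case i of (x, y) \<Rightarrow> {..<y}} \<and>
        e \<in> (case i of (x, y) \<Rightarrow> R x y) \<and> snd i \<in> (case i of (x, y) \<Rightarrow> R x y)"
      using R[OF i(3)] i by (simp add: insert_commute)
    have "closure {x<..} \<subseteq> {x..}" by (rule closure_minimal) auto
    then show "c \<notin> closure (case i of (x, y) \<Rightarrow> {x<..})"
      using i by auto
    show "(case i of (x, y) \<Rightarrow> {..<y}) \<subseteq> {..<e}" using i by auto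
  qed auto
  moreover have "snd ` I = {y | x y. c < x \<and> x < y \<and> y \<le> e \<and> e \<in> R x y}"
    by (force simp: I_def)
  ultimately show ?thesis by simp
qed

text \<open>Mirror image: \<open>{p<..}\<close> absorbs the sets \<open>{x<..}\<close>, and the rays
  \<open>{..<y}\<close> stay away from \<open>c\<close>.\<close>

lemma left_ends_not_accumulating:
  fixes r :: "'a::linorder_topology set set \<Rightarrow> 'a set set"
  assumes r: "monotone_open_closure_preserving_operator r"
    and L: "\<And>x y. x < y \<Longrightarrow> x \<in> L x y \<and> L x y \<in> r {{..<y}, {x<..}}"
  shows "c \<notin> closure {x | x y. p \<le> x \<and> x < y \<and> y < c \<and> p \<in> L x y}"
proof -
  define I where "I = {(x, y). p \<le> x \<and> x < y \<and> y < c \<and> p \<in> L x y}"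
  have "c \<notin> closure (fst ` I)"
  proof (rule closure_preserving_witnesses[OF r,
        where U = "\<lambda>(x, y). {..<y}" and O' = "\<lambda>(x, y). {x<..}" and V = "\<lambda>(x, y). L x y"
          and Q = "{p<..}" and p = p])
    fix i assume "i \<in> I"
    then obtain x y where i: "i = (x, y)" "p \<le> x" "x < y" "y < c" "p \<in> L x y"
      by (auto simp: I_def)
    show "open_cover {case i of (x, y) \<Rightarrow> {..<y}, case i of (x, y) \<Rightarrow> {x<..}}"
      using open_cover_rays[OF i(3)] i(1) by simp
    show "(case i of (x, y) \<Rightarrow> L x y)
        \<in> r {case i of (x, y) \<Rightarrow> {..<y}, case i of (x, y) \<Rightarrow> {x<..}} \<and>
        p \<in> (case i of (x, y) \<Rightarrow> L x y) \<and> fst i \<in> (case i of (x, y) \<Rightarrow> L x y)"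
      using L[OF i(3)] i by simp
    have "closure {..<y} \<subseteq> {..y}" by (rule closure_minimal) auto
    then show "c \<notin> closure (case i of (x, y) \<Rightarrow> {..<y})"
      using i by auto
    show "(case i of (x, y) \<Rightarrow> {x<..}) \<subseteq> {p<..}" using i by auto
  qed auto
  moreover have "fst ` I = {x | x y. p \<le> x \<and> x < y \<and> y < c \<and> p \<in> L x y}"
    by (force simp: I_def)
  ultimately show ?thesis by simp
qed

section \<open>Piercing a family of intervals by finitely many points\<close>

text \<open>An interval of the family starting close enough to \<open>c\<close> either contains
  \<open>c\<close> or starts after \<open>c\<close> and reaches a fixed \<open>t > c\<close>. So
  \<open>{c, t}\<close> meets all intervals starting near \<open>c\<close>, and finitely many such
  neighbourhoods cover the space.\<close>

lemma finite_piercing_set: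
  fixes P :: "('a::linorder_topology \<times> 'a) set"
  assumes compact: "compact (UNIV :: 'a set)"
    and right: "\<And>c. c \<notin> closure {y | x y. c < x \<and> (x, y) \<in> P}"
    and left: "\<And>c. c \<notin> closure {x | x y. y < c \<and> (x, y) \<in> P}"
    and P: "\<And>x y. (x, y) \<in> P \<Longrightarrow> x < y"
  shows "\<exists>F. finite F \<and> (\<forall>x y. (x, y) \<in> P \<longrightarrow> F \<inter> {x..y} \<noteq> {})"
proof -
  have "\<exists>M F. open M \<and> c \<in> M \<and> finite F \<and>
      (\<forall>x y. (x, y) \<in> P \<longrightarrow> x \<in> M \<longrightarrow> F \<inter> {x..y} \<noteq> {})" for c
  proof -
    define Y where "Y = {y | x y. c < x \<and> (x, y) \<in> P}"
    define X where "X = {x | x y. y < c \<and> (x, y) \<in> P}"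
    define N where "N = - closure Y - closure X"
    have N: "open N" "c \<in> N"
      unfolding N_def X_def Y_def using left right by (auto intro: open_Diff)
    have disj: "Y \<inter> N = {}" "X \<inter> N = {}"
      unfolding N_def using closure_subset[of X] closure_subset[of Y] by auto
    have N_right: "y \<notin> N" if "c < x" "(x, y) \<in> P" for x y
    proof -
      have "y \<in> Y" unfolding Y_def using that by blast
      then show ?thesis using disj by blast
    qed
    have N_left: "x \<notin> N" if "y < c" "(x, y) \<in> P" for x y
    proof -
      have "x \<in> X" unfolding X_def using that by blast
      then show ?thesis using disj by blast
    qed
    show ?thesis
    proof (cases "\<exists>u. c < u")
      case True
      then obtain t where t: "t > c" "{c..<t} \<subseteq> N"
        using open_right N by blast
      \<comment> \<open>An interval avoiding both \<open>c\<close> and \<open>t\<close> would start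
        after \<open>c\<close> and end before \<open>t\<close>, hence end inside \<open>N\<close>,
        against \<open>N_right\<close>.\<close>
      have "{c, t} \<inter> {x..y} \<noteq> {}" if "(x, y) \<in> P" "x \<in> N \<inter> {..<t}" for x y
      proof (rule ccontr)
        assume "\<not> ?thesis"
        moreover have "c \<le> y" using N_left[of y x] that by (meson IntD1 not_less)
        ultimately have "c < x" "y < t" using that P[OF that(1)] t(1) by auto
        then have "y \<in> N" using t \<open>c \<le> y\<close> by auto
        then show False using N_right[OF \<open>c < x\<close> that(1)] by simp
      qed
      moreover have "open (N \<inter> {..<t})" "c \<in> N \<inter> {..<t}" "finite {c, t}"
        using N t by auto
      ultimately show ?thesis by blast
    next
      \<comment> \<open>Now \<open>c\<close> is the greatest element, so no interval can start after
        it.\<close>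
      case False
      have "{c} \<inter> {x..y} \<noteq> {}" if "(x, y) \<in> P" "x \<in> N" for x y
      proof -
        have "c \<le> y" using N_left[of y x] that by (meson not_less)
        moreover have "x \<le> c" using False by (simp add: not_less)
        ultimately show ?thesis by simp
      qed
      moreover have "finite {c}" by simp
      ultimately show ?thesis using N by blast
    qed
  qed
  then obtain M F where MF: "\<And>c. open (M c) \<and> c \<in> M c \<and> finite (F c) \<and>
      (\<forall>x y. (x, y) \<in> P \<longrightarrow> x \<in> M c \<longrightarrow> F c \<inter> {x..y} \<noteq> {})"
    by metis
  obtain C where C: "finite C" "UNIV \<subseteq> (\<Union>c\<in>C. M c)"
  proof (rule compactE_image[OF compact])
    show "open (M c)" for c using MF by blast
    show "UNIV \<subseteq> (\<Union>c\<in>UNIV. M c)" using MF by blast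
  qed
  have "(\<Union>c\<in>C. F c) \<inter> {x..y} \<noteq> {}" if "(x, y) \<in> P" for x y
  proof -
    obtain c where "c \<in> C" "x \<in> M c" using C by blast
    then have "F c \<inter> {x..y} \<noteq> {}" using MF[of c] that by simp
    then show ?thesis using \<open>c \<in> C\<close> by blast
  qed
  moreover have "finite (\<Union>c\<in>C. F c)" using C MF by simp
  ultimately show ?thesis by blast
qed

section \<open>A countable set meeting every nondegenerate interval\<close>

lemma countable_closed_under:
  assumes "\<And>p e. countable (F p e)" "countable D0"
  shows "\<exists>D. countable D \<and> D0 \<subseteq> D \<and> (\<forall>p\<in>D. \<forall>e\<in>D. F p e \<subseteq> D)"
proof -
  define G where "G = rec_nat D0 (\<lambda>_ A. A \<union> (\<Union>p\<in>A. \<Union>e\<in>A. F p e))"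
  have G: "G 0 = D0" "G (Suc n) = G n \<union> (\<Union>p\<in>G n. \<Union>e\<in>G n. F p e)" for n
    by (simp_all add: G_def)
  have countable: "countable (G n)" for n
    by (induction n) (use assms G in auto)
  have "mono G"
    using G by (auto simp: mono_iff_le_Suc)
  have closed: "F p e \<subseteq> (\<Union>n. G n)" if "p \<in> G m" "e \<in> G n" for p e m n
  proof -
    have "p \<in> G (max m n)" "e \<in> G (max m n)"
      using that \<open>mono G\<close> by (meson monoD max.cobounded1 max.cobounded2 subsetD)+
    then have "F p e \<subseteq> G (Suc (max m n))" using G by auto
    then show ?thesis by blast
  qed
  show ?thesis
  proof (intro exI[of _ "\<Union>n. G n"] conjI ballI)
    show "D0 \<subseteq> (\<Union>n. G n)" using G(1) by blast
    show "F p e \<subseteq> (\<Union>n. G n)" if "p \<in> (\<Union>n. G n)" "e \<in> (\<Union>n. G n)" for p e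
      using closed that by blast
  qed (use countable in auto)
qed

text \<open>The maximum of the compact set \<open>closure A\<close> serves as supremum. Its
  membership in the closure later supplies points of \<open>A\<close> in every neighbourhood of
  it.\<close>

lemma compact_closure_sup:
  fixes A :: "'a::linorder_topology set"
  assumes "compact (UNIV :: 'a set)" "A \<noteq> {}"
  obtains a where "a \<in> closure A" "\<And>d. d \<in> A \<Longrightarrow> d \<le> a"
proof -
  have "compact (closure A)"
    using compact_Int_closed[OF assms(1), of "closure A"] by simp
  then show thesis
    using compact_attains_sup[of "closure A"] assms that closure_subset[of A] by auto
qed

lemma compact_closure_inf:
  fixes A :: "'a::linorder_topology set"
  assumes "compact (UNIV :: 'a set)" "A \<noteq> {}"
  obtains a where "a \<in> closure A" "\<And>d. d \<in> A \<Longrightarrow> a \<le> d"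
proof -
  have "compact (closure A)"
    using compact_Int_closed[OF assms(1), of "closure A"] by simp
  then show thesis
    using compact_attains_inf[of "closure A"] assms that closure_subset[of A] by auto
qed

lemma countable_set_meeting_intervals:
  fixes r :: "'a::linorder_topology set set \<Rightarrow> 'a set set"
  assumes compact: "compact (UNIV :: 'a set)"
    and r: "monotone_open_closure_preserving_operator r"
  obtains D :: "'a set" where "countable D" "\<And>x y. x < y \<Longrightarrow> D \<inter> {x..y} \<noteq> {}"
proof -
  have r_cover: "open_cover (r \<U>)" if "open_cover \<U>" for \<U>
    using r that by (auto simp: monotone_open_closure_preserving_operator_def)
  have cover: "\<exists>V. z \<in> V \<and> V \<in> r {{..<y}, {x<..}}" if "x < y" for x y z
  proof -
    have "z \<in> \<Union>(r {{..<y}, {x<..}})"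
      using r_cover[OF open_cover_rays[OF that]] by (simp add: open_cover_def)
    then show ?thesis by blast
  qed
  \<comment> \<open>One choice serves both ends: \<open>L\<close> uses it at \<open>x\<close>,
    \<open>R\<close> at \<open>y\<close>. Its values for \<open>y \<le> x\<close> are arbitrary and
    harmless.\<close>
  define V where "V z x y = (SOME V. z \<in> V \<and> V \<in> r {{..<y}, {x<..}})" for x y z
  have V: "z \<in> V z x y \<and> V z x y \<in> r {{..<y}, {x<..}}" if "x < y" for x y z
    unfolding V_def using cover[OF that] by (rule someI_ex)
  define L where "L x y = V x x y" for x y
  define R where "R x y = V y x y" for x y
  have L: "x \<in> L x y \<and> L x y \<in> r {{..<y}, {x<..}}"
    and R: "y \<in> R x y \<and> R x y \<in> r {{..<y}, {x<..}}" if "x < y" for x y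
    unfolding L_def R_def using V[OF that] by auto
  have open_LR: "open (L x y)" "open (R x y)" if "x < y" for x y
  proof -
    have "open W" if "W \<in> r {{..<y}, {x<..}}" for W
      using r_cover[OF open_cover_rays[OF \<open>x < y\<close>]] that by (simp add: open_cover_def)
    then show "open (L x y)" "open (R x y)"
      using L[OF that] R[OF that] by simp_all
  qed
  note right = right_ends_not_accumulating[OF r R] and left = left_ends_not_accumulating[OF r L]

  have "\<exists>F. finite F \<and>
     (\<forall>x y. p \<le> x \<and> x < y \<and> y \<le> e \<and> p \<in> L x y \<and> e \<in> R x y \<longrightarrow> F \<inter> {x..y} \<noteq> {})" for p e
  proof -
    define P where "P = {(x, y). p \<le> x \<and> x < y \<and> y \<le> e \<and> p \<in> L x y \<and> e \<in> R x y}"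
    have right_P: "c \<notin> closure {y | x y. c < x \<and> (x, y) \<in> P}" for c
    proof -
      have "{y | x y. c < x \<and> (x, y) \<in> P}
          \<subseteq> {y | x y. c < x \<and> x < y \<and> y \<le> e \<and> e \<in> R x y}"
        by (auto simp: P_def)
      from closure_mono[OF this] show ?thesis using right[of c e] by blast
    qed
    have left_P: "c \<notin> closure {x | x y. y < c \<and> (x, y) \<in> P}" for c
    proof -
      have "{x | x y. y < c \<and> (x, y) \<in> P}
          \<subseteq> {x | x y. p \<le> x \<and> x < y \<and> y < c \<and> p \<in> L x y}"
        by (auto simp: P_def)
      from closure_mono[OF this] show ?thesis using left[of c p] by blast
    qed
    have "x < y" if "(x, y) \<in> P" for x y
      using that by (simp add: P_def)
    with compact right_P left_P
    have "\<exists>F. finite F \<and> (\<forall>x y. (x, y) \<in> P \<longrightarrow> F \<inter> {x..y} \<noteq> {})"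
      by (rule finite_piercing_set)
    then show ?thesis by (simp only: P_def mem_Collect_eq case_prod_conv)
  qed
  then obtain F where F: "\<And>p e. finite (F p e)"
    "\<And>p e x y. \<lbrakk>p \<le> x; x < y; y \<le> e; p \<in> L x y; e \<in> R x y\<rbrakk> \<Longrightarrow> F p e \<inter> {x..y} \<noteq> {}"
    by metis

  \<comment> \<open>The bound \<open>t\<close> depends only on \<open>a\<close> and
    \<open>e\<close>, not on the interval, so a countable set can be closed under it. It settles
    gaps whose left end alone belongs to \<open>D\<close>; \<open>s\<close> below does the same for
    right ends.\<close>
  have ex_t: "\<exists>t>a. \<forall>x y. a < x \<and> x < y \<and> y \<le> e \<and> e \<in> R x y \<longrightarrow> t \<le> y" if "a < e" for a e
  proof -
    define S where "S = {y | x y. a < x \<and> x < y \<and> y \<le> e \<and> e \<in> R x y}"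
    have "open (- closure S)" "a \<in> - closure S"
      using right[of a e] by (auto simp: S_def)
    then obtain t where t: "t > a" "{a..<t} \<subseteq> - closure S"
      using open_right \<open>a < e\<close> by blast
    have "t \<le> y" if "a < x" "x < y" "y \<le> e" "e \<in> R x y" for x y
    proof (rule ccontr)
      assume "\<not> t \<le> y"
      then have "y \<in> {a..<t}" using that by auto
      moreover have "y \<in> S" using that by (auto simp: S_def)
      ultimately show False using t closure_subset[of S] by blast
    qed
    then show ?thesis using t by blast
  qed
  define t where "t a e = (SOME t. a < t \<and>
    (\<forall>x y. a < x \<and> x < y \<and> y \<le> e \<and> e \<in> R x y \<longrightarrow> t \<le> y))" for a e
  have t: "a < t a e" "\<And>x y. \<lbrakk>a < x; x < y; y \<le> e; e \<in> R x y\<rbrakk> \<Longrightarrow> t a e \<le> y"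
    if "a < e" for a e
    using someI_ex[OF ex_t[OF that]] unfolding t_def by blast+

  have ex_s: "\<exists>s<b. \<forall>x y. p \<le> x \<and> x < y \<and> y < b \<and> p \<in> L x y \<longrightarrow> x \<le> s" if "p < b" for b p
  proof -
    define S where "S = {x | x y. p \<le> x \<and> x < y \<and> y < b \<and> p \<in> L x y}"
    have "open (- closure S)" "b \<in> - closure S"
      using left[of b p] by (auto simp: S_def)
    then obtain s where s: "s < b" "{s<..b} \<subseteq> - closure S"
      using open_left \<open>p < b\<close> by blast
    have "x \<le> s" if "p \<le> x" "x < y" "y < b" "p \<in> L x y" for x y
    proof (rule ccontr)
      assume "\<not> x \<le> s"
      then have "x \<in> {s<..b}" using that by auto
      moreover have "x \<in> S" using that by (auto simp: S_def)
      ultimately show False using s closure_subset[of S] by blast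
    qed
    then show ?thesis using s by blast
  qed
  define s where "s p b = (SOME s. s < b \<and>
    (\<forall>x y. p \<le> x \<and> x < y \<and> y < b \<and> p \<in> L x y \<longrightarrow> x \<le> s))" for p b
  have s: "s p b < b" "\<And>x y. \<lbrakk>p \<le> x; x < y; y < b; p \<in> L x y\<rbrakk> \<Longrightarrow> x \<le> s p b"
    if "p < b" for p b
    using someI_ex[OF ex_s[OF that]] unfolding s_def by blast+

  \<comment> \<open>At a jump this is an arbitrary element, which costs nothing beyond
    countability.\<close>
  define m where "m a b = (SOME z. a < z \<and> z < b)" for a b :: 'a
  have m: "a < m a b \<and> m a b < b" if "a < x" "x < b" for a x b
    unfolding m_def by (rule someI[of _ x]) (simp add: that)

  obtain l :: 'a where l: "\<And>x. l \<le> x"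
    using compact_attains_inf[OF compact] by auto
  obtain g :: 'a where g: "\<And>x. x \<le> g"
    using compact_attains_sup[OF compact] by auto

  define F' where "F' p e = F p e \<union> {t p e, s p e, m p e}" for p e
  have "countable (F' p e)" for p e
    unfolding F'_def using F(1) by (simp add: countable_finite)
  moreover have "countable {l, g}" by simp
  ultimately obtain D where D: "countable D" "{l, g} \<subseteq> D" and D_F': "\<forall>p\<in>D. \<forall>e\<in>D. F' p e \<subseteq> D"
    using countable_closed_under[of F' "{l, g}"] by blast
  have D_closed: "F p e \<subseteq> D" "t p e \<in> D" "s p e \<in> D" "m p e \<in> D" if "p \<in> D" "e \<in> D" for p e
    using D_F' that unfolding F'_def by blast+

  have meets: "D \<inter> {x..y} \<noteq> {}" if xy: "x < y" for x y
  proof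
    assume disj: "D \<inter> {x..y} = {}"
    then have xyD: "x \<notin> D" "y \<notin> D" using xy by auto
    define A where "A = {d \<in> D. d < x}"
    define B where "B = {d \<in> D. y < d}"
    have "l \<in> A" "g \<in> B"
      using D l[of x] g[of y] xyD by (auto simp: A_def B_def less_le)
    \<comment> \<open>The extreme points \<open>l\<close> and \<open>g\<close> were put into
      \<open>D\<close> so that it has points on both sides of \<open>[x, y]\<close>.\<close>
    then have "A \<noteq> {}" "B \<noteq> {}" by auto
    obtain a where a: "a \<in> closure A" "\<And>d. d \<in> A \<Longrightarrow> d \<le> a"
      using compact_closure_sup[OF compact \<open>A \<noteq> {}\<close>] by blast
    obtain b where b: "b \<in> closure B" "\<And>d. d \<in> B \<Longrightarrow> b \<le> d"
      using compact_closure_inf[OF compact \<open>B \<noteq> {}\<close>] by blast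
    have "closure A \<subseteq> {..x}" by (rule closure_minimal) (auto simp: A_def)
    then have "a \<le> x" using a by auto
    have "closure B \<subseteq> {y..}" by (rule closure_minimal) (auto simp: B_def)
    then have "y \<le> b" using b by auto
    have gap: "d \<le> a \<or> b \<le> d" if "d \<in> D" for d
      using a(2)[of d] b(2)[of d] that disj by (fastforce simp: A_def B_def)
    have A_dense: "\<exists>p\<in>D. p \<in> V \<and> p \<le> a" if "open V" "a \<in> V" for V
      using that a open_Int_closure_eq_empty[of V A] by (auto simp: A_def)
    have B_dense: "\<exists>e\<in>D. e \<in> V \<and> b \<le> e" if "open V" "b \<in> V" for V
      using that b open_Int_closure_eq_empty[of V B] by (auto simp: B_def)
    have "a < b" using \<open>a \<le> x\<close> \<open>y \<le> b\<close> xy by simp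
    obtain p where p: "p \<in> D" "p \<in> L a b" "p \<le> a"
      using A_dense[of "L a b"] L open_LR \<open>a < b\<close> by blast
    obtain e where e: "e \<in> D" "e \<in> R a b" "b \<le> e"
      using B_dense[of "R a b"] R open_LR \<open>a < b\<close> by blast
    have "F p e \<inter> {a..b} \<noteq> {}" using F(2) p e \<open>a < b\<close> by blast
    then obtain d where "d \<in> F p e" "a \<le> d" "d \<le> b"
      by auto
    moreover from this have "d \<in> D"
      using D_closed(1)[OF p(1) e(1)] by blast
    \<comment> \<open>By \<open>gap\<close>, a point of \<open>D\<close> in \<open>[a, b]\<close>
      can only be \<open>a\<close> or \<open>b\<close>, so at least one end of the gap is in
      \<open>D\<close>.\<close>
    ultimately consider "a \<in> D" "b \<in> D" | "a \<in> D" "b \<notin> D" | "a \<notin> D" "b \<in> D"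
      using gap[of d] by fastforce
    then show False
    proof cases
      case 1
      then have "a < x" "x < b" using \<open>a \<le> x\<close> \<open>y \<le> b\<close> xy xyD by (auto simp: less_le)
      then show False
        using m[of a x b] gap[of "m a b"] D_closed(4)[OF 1] by force
    next
      \<comment> \<open>Here \<open>[x, b]\<close> replaces \<open>[a, b]\<close>: it starts
        strictly after \<open>a\<close>, so \<open>a < t a e \<le> b\<close>. Then
        \<open>gap\<close> forces \<open>t a e = b\<close>, although \<open>b\<close> is not in
        \<open>D\<close>.\<close>
      case 2
      then have ax: "a < x" "x < b" using \<open>a \<le> x\<close> \<open>y \<le> b\<close> xy xyD by (auto simp: less_le)
      obtain e where e: "e \<in> D" "e \<in> R x b" "b \<le> e"
        using B_dense[of "R x b"] R open_LR ax by blast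
      have "a < t a e" "t a e \<le> b" "t a e \<in> D"
        using t(1)[of a e] t(2)[of a e x b] ax e D_closed(2)[OF 2(1) e(1)] by auto
      then show False
        using gap[of "t a e"] 2 by force
    next
      \<comment> \<open>Symmetrically, \<open>[a, y]\<close> ends strictly before \<open>b\<close>,
        and \<open>s p b\<close> would have to equal \<open>a\<close>.\<close>
      case 3
      then have ay: "a < y" "y < b" using \<open>a \<le> x\<close> \<open>y \<le> b\<close> xy xyD by (auto simp: less_le)
      obtain p where p: "p \<in> D" "p \<in> L a y" "p \<le> a"
        using A_dense[of "L a y"] L open_LR ay by blast
      have "s p b < b" "a \<le> s p b" "s p b \<in> D"
        using s(1)[of p b] s(2)[of p b a y] ay p D_closed(3)[OF p(1) 3(2)] by auto
      then show False
        using gap[of "s p b"] 3 by force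
    qed
  qed
  show thesis by (rule that[OF D(1) meets])
qed

section \<open>Two points in every interval\<close>

text \<open>Separating \<open>x\<close> from \<open>y\<close> by a Urysohn function takes two points
  between them. At a jump the second one is the immediate neighbour of the first; otherwise the
  interval is split at an interior point.\<close>

lemma countable_set_meeting_intervals_twice:
  fixes D :: "'a::linorder set"
  assumes "countable D" and D: "\<And>x y. x < y \<Longrightarrow> D \<inter> {x..y} \<noteq> {}"
  obtains E :: "'a set" where "countable E"
    "\<And>x y. x < y \<Longrightarrow> \<exists>d\<in>E. \<exists>d'\<in>E. x \<le> d \<and> d < d' \<and> d' \<le> y"
proof -
  \<comment> \<open>Where no immediate neighbour exists, \<open>THE\<close> yields an unspecified
    element, so \<open>E\<close> stays countable all the same.\<close>
  define succ where "succ x = (THE y. x < y \<and> {x<..<y} = {})" for x :: 'a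
  define pred where "pred y = (THE x. x < y \<and> {x<..<y} = {})" for y :: 'a
  have succ: "succ x = y" and pred: "pred y = x" if "x < y" "{x<..<y} = {}" for x y
  proof -
    have none: "\<not> (x < z \<and> z < y)" for z using that(2) by auto
    show "succ x = y"
      unfolding succ_def
    proof (rule the_equality)
      fix z assume z: "x < z \<and> {x<..<z} = {}"
      then have "y \<notin> {x<..<z}" by blast
      then have "z \<le> y" using \<open>x < y\<close> by simp
      then show "z = y" using z none[of z] by simp
    qed (use that in simp)
    show "pred y = x"
      unfolding pred_def
    proof (rule the_equality)
      fix z assume z: "z < y \<and> {z<..<y} = {}"
      then have "x \<notin> {z<..<y}" by blast
      then have "x \<le> z" using \<open>x < y\<close> by simp
      then show "z = x" using z none[of z] by (simp add: not_less)
    qed (use that in simp)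
  qed
  define E where "E = D \<union> succ ` D \<union> pred ` D"
  have jump: "x \<in> E \<and> y \<in> E" if jump: "x < y" "{x<..<y} = {}" for x y
  proof -
    have "x \<in> D \<or> y \<in> D"
    proof -
      obtain d where "d \<in> D" "x \<le> d" "d \<le> y" using D[OF jump(1)] by auto
      moreover have "\<not> (x < d \<and> d < y)" using jump(2) by auto
      ultimately show ?thesis by (metis order.order_iff_strict)
    qed
    then show ?thesis unfolding E_def using succ[OF jump] pred[OF jump] by (metis UnI1 UnI2 imageI)
  qed
  have "\<exists>d\<in>E. \<exists>d'\<in>E. x \<le> d \<and> d < d' \<and> d' \<le> y" if "x < y" for x y
  proof (cases "{x<..<y} = {}")
    case True
    then show ?thesis using jump[OF that True] that by auto
  next
    case False
    then obtain z where z: "x < z" "z < y" by auto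
    obtain d d' where d: "d \<in> D" "x \<le> d" "d \<le> z" "d' \<in> D" "z \<le> d'" "d' \<le> y"
      using D[of x z] D[of z y] z by fastforce
    show ?thesis
    proof (cases "d < d'")
      case True
      then show ?thesis using d by (auto simp: E_def)
    next
      case False
      \<comment> \<open>From \<open>d \<le> z \<le> d'\<close> and not \<open>d < d'\<close>, both
        points coincide with \<open>z\<close>; a second point is then sought to the left of
        \<open>z\<close>.\<close>
      then have "z \<in> D" using d by (metis order.order_iff_strict order.strict_trans1)
      show ?thesis
      proof (cases "{x<..<z} = {}")
        case True
        then have "x \<in> E" "z \<in> E" using jump[OF z(1)] by auto
        then show ?thesis using z by (intro bexI[of _ x] bexI[of _ z]) auto
      next
        case False
        then obtain w where w: "x < w" "w < z" by auto
        then obtain d'' where "d'' \<in> D" "x \<le> d''" "d'' \<le> w" using D[of x w] w by fastforce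
        then show ?thesis
          using \<open>z \<in> D\<close> w z by (intro bexI[of _ d''] bexI[of _ z]) (auto simp: E_def)
      qed
    qed
  qed
  then show thesis
    using that[of E] \<open>countable D\<close> by (auto simp: E_def)
qed

section \<open>Embedding into a countable power of the reals\<close>

text \<open>The diagonal map of the functions is a continuous injection of a compact space into a
  Hausdorff one, hence an embedding, and a countable product of real lines is metrizable.\<close>

lemma metrizable_space_if_countable_separating:
  fixes f :: "'i \<Rightarrow> 'a \<Rightarrow> real"
  assumes "compact_space X" "countable I"
    and cont: "\<And>i. i \<in> I \<Longrightarrow> continuous_map X euclideanreal (f i)"
    and sep: "\<And>x y. \<lbrakk>x \<in> topspace X; y \<in> topspace X; x \<noteq> y\<rbrakk> \<Longrightarrow> \<exists>i\<in>I. f i x \<noteq> f i y"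
  shows "metrizable_space X"
proof -
  define Y where "Y = product_topology (\<lambda>i. euclideanreal) I"
  define \<phi> where "\<phi> = (\<lambda>x. \<lambda>i\<in>I. f i x)"
  have "metrizable_space Y"
    unfolding Y_def metrizable_space_product_topology
    using \<open>countable I\<close> by (auto simp: metrizable_space_euclidean)
  have "continuous_map X Y \<phi>"
    unfolding Y_def \<phi>_def using cont by (auto simp: continuous_map_componentwise)
  moreover have "inj_on \<phi> (topspace X)"
    unfolding inj_on_def \<phi>_def using sep by (metis restrict_apply')
  moreover have "Hausdorff_space Y"
    using \<open>metrizable_space Y\<close> by (rule metrizable_imp_Hausdorff_space)
  ultimately have "embedding_map X Y \<phi>"
    using \<open>compact_space X\<close> by (intro continuous_imp_embedding_map)
  then show ?thesis
    using \<open>metrizable_space Y\<close> embedding_map_imp_homeomorphic_space homeomorphic_metrizable_space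
      metrizable_space_subtopology by blast
qed

theorem theorem3p8:
  fixes r :: "'a::linorder_topology set set \<Rightarrow> 'a set set"
  assumes "compact (UNIV :: 'a set)"
    and "monotone_open_closure_preserving_operator r"
  shows "metrizable_space (euclidean :: 'a topology)"
proof -
  let ?X = "euclidean :: 'a topology"
  obtain D :: "'a set" where "countable D" "\<And>x y. x < y \<Longrightarrow> D \<inter> {x..y} \<noteq> {}"
    using countable_set_meeting_intervals[OF assms] by blast
  then obtain E :: "'a set" where E: "countable E"
    "\<And>x y. x < y \<Longrightarrow> \<exists>d\<in>E. \<exists>d'\<in>E. x \<le> d \<and> d < d' \<and> d' \<le> y"
    using countable_set_meeting_intervals_twice by blast
  have "compact_space ?X"
    using assms(1) by (simp add: compact_space_def)
  have "Hausdorff_space ?X"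
    unfolding Hausdorff_space_def disjnt_def by (simp, metis hausdorff)
  then have "normal_space ?X"
    using \<open>compact_space ?X\<close> compact_Hausdorff_or_regular_imp_normal_space by blast
  \<comment> \<open>For \<open>d < d'\<close> the closed rays \<open>{..d}\<close> and
    \<open>{d'..}\<close> are disjoint. Any \<open>x \<le> d\<close> and \<open>y \<ge> d'\<close>
    therefore get different values.\<close>
  have "\<exists>f. continuous_map ?X euclideanreal f \<and> f ` {..d} \<subseteq> {0} \<and> f ` {d'..} \<subseteq> {1}"
    if "d < d'" for d d'
    using Urysohn_lemma_alt[OF \<open>normal_space ?X\<close>, of "{..d}" "{d'..}" 0 1] that
    by (fastforce simp: disjnt_def)
  then obtain f where f: "\<And>d d'. d < d' \<Longrightarrow> continuous_map ?X euclideanreal (f d d') \<and>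
      f d d' ` {..d} \<subseteq> {0} \<and> f d d' ` {d'..} \<subseteq> {1}"
    by metis
  define I where "I = {(d, d'). d \<in> E \<and> d' \<in> E \<and> d < d'}"
  have sep: "\<exists>i\<in>I. case_prod f i x \<noteq> case_prod f i y" if xy: "x < y" for x y
  proof -
    obtain d d' where d: "d \<in> E" "d' \<in> E" "x \<le> d" "d < d'" "d' \<le> y"
      using E(2)[OF xy] by blast
    then have "f d d' x = 0" "f d d' y = 1"
      using f[of d d'] by auto
    then show ?thesis
      using d by (intro bexI[of _ "(d, d')"]) (auto simp: I_def)
  qed
  show ?thesis
  proof (rule metrizable_space_if_countable_separating[where f = "case_prod f" and I = I])
    show "countable I"
      by (rule countable_subset[of _ "E \<times> E"]) (auto simp: I_def E(1))
    show "\<exists>i\<in>I. case_prod f i x \<noteq> case_prod f i y" if "x \<noteq> y" for x y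
      using sep[of x y] sep[of y x] that by (metis linorder_neqE)
  qed (use f \<open>compact_space ?X\<close> in \<open>auto simp: I_def\<close>)
qed

end
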